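(* Let $\ell$ be a positive integer, let $V$ be a finite set of cardinality $n$, and let $\mathcal{F}$ be a set of finite sequences over $V$. Let $L,L',K,J,s$ be integers (possibly depending on $\ell$) such that $\mathcal{F}$ has the $L$-suffix, $L'$-prefix, $K$-insertion and $(J,s)$-reachability properties (with respect to $\ell$). Then there exists an $(\ell,\mathcal{F})$-good sequencing of $V$ whenever $$n\geq \ell L+(L+L'+K)L+sL+J.$$ If $\mathcal{F}$ is symmetric, then there exists an $(\ell,\mathcal{F})$-good sequencing of $V$ whenever $$n\geq \ell L+(L+K)L+sL+J.$$
   Context: Let $V$ be a finite set with $|V|=n$, $\mathcal{F}$ a set of finite sequences over $V$, and $\ell$ a positive integer. A sequence over $V$ is a partial sequencing if its entries are distinct; it is a sequencing (of $V$) if in addition its length is $n$. A subsequence need not consist of consecutive entries; a segment is a subsequence of consecutive entries. A sequence is $\mathcal{F}$-good if none of its subsequences lies in $\mathcal{F}$. A sequence (partial sequencing, sequencing) is $(\ell,\mathcal{F})$-good if its entries are distinct and all its segments of length $\ell$ or less are $\mathcal{F}$-good. $L$-suffix property: for every integer $r$ with $0\le r\leq \ell-1$ and every $\mathcal{F}$-good sequence $x_1,\ldots,x_r$ over $V$, there are at most $L$ elements $x\in V$ such that $x_1,\ldots,x_r,x$ fails to be $\mathcal{F}$-good. $L'$-prefix property: for every integer $r$ with $0\le r\leq \ell-1$ and every $\mathcal{F}$-good sequence $x_1,\ldots,x_r$ over $V$, there are at most $L'$ elements $x\in V$ such that $x,x_1,\ldots,x_r$ fails to be $\mathcal{F}$-good.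 Symmetric: $\mathcal{F}$ is symmetric if for every sequence $x_1,\ldots,x_r$ as in the two properties above, the set of $x\in V$ for which $x_1,\ldots,x_r,x$ fails to be $\mathcal{F}$-good equals the set of $x\in V$ for which $x,x_1,\ldots,x_r$ fails to be $\mathcal{F}$-good. $K$-insertion property: for every $(\ell,\mathcal{F})$-good sequence $x_1,\ldots,x_{2\ell-2}$ over $V$, there are at most $K$ elements $x\in V$ such that the sequences $x_1,\ldots,x_{\ell-1},x$ and $x,x_\ell,\ldots,x_{2\ell-2}$ are both $(\ell,\mathcal{F})$-good but $x_1,\ldots,x_{\ell-1},x,x_\ell,\ldots,x_{2\ell-2}$ fails to be $(\ell,\mathcal{F})$-good. $(J,s)$-reachability property: for every $W\subseteq V$ with $|W|\geq J$, every $(\ell,\mathcal{F})$-good partial sequencing $x_1,\ldots,x_{\ell-1}$ none of whose entries lies in $W$, and every $w\in W$, there exist $w_1,\ldots,w_s\in W$ such that $x_1,\ldots,x_{\ell-1},w_1,\ldots,w_s,w$ is an $(\ell,\mathcal{F})$-good partial sequencing.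
   Formalization: The integers L, L', K, J, s are taken to be nonnegative, and the empty sequence is not counted as a subsequence in the definition of F-good; without these conventions the claim fails in degenerate cases. *)

theory Defs
  imports "HOL-Library.Sublist"
begin

text \<open>
  Finite sequences are lists. Subsequences in the sense of \<^const>\<open>subseq\<close> need not be
  contiguous; segments are contiguous sublists in the sense of \<^const>\<open>sublist\<close>.
\<close>

definition partial_sequencing :: "'a set \<Rightarrow> 'a list \<Rightarrow> bool" where
  "partial_sequencing V xs \<longleftrightarrow> set xs \<subseteq> V \<and> distinct xs"

definition sequencing :: "'a set \<Rightarrow> 'a list \<Rightarrow> bool" where
  "sequencing V xs \<longleftrightarrow> partial_sequencing V xs \<and> length xs = card V"

text \<open>
  The empty list does not count as a subsequence here. If it did, then \<open>[] \<in> F\<close> would leave no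
  sequence good, and all the properties below would hold vacuously for all values of their
  parameters. For \<open>[] \<notin> F\<close> the restriction makes no difference.
\<close>

definition good :: "'a list set \<Rightarrow> 'a list \<Rightarrow> bool" where
  "good F xs \<longleftrightarrow> (\<forall>ys. subseq ys xs \<and> ys \<noteq> [] \<longrightarrow> ys \<notin> F)"

definition lgood :: "nat \<Rightarrow> 'a list set \<Rightarrow> 'a list \<Rightarrow> bool" where
  "lgood l F xs \<longleftrightarrow>
     distinct xs \<and> (\<forall>ys. sublist ys xs \<and> length ys \<le> l \<longrightarrow> good F ys)"

text \<open>
  The definitions below are meant for finite \<open>V\<close> and \<open>l > 0\<close>, so that the cardinalities are
  genuine and the subtraction \<open>l - 1\<close> is not truncated.
\<close>

definition suffix_property :: "'a set \<Rightarrow> nat \<Rightarrow> 'a list set \<Rightarrow> nat \<Rightarrow> bool" where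
  "suffix_property V l F L \<longleftrightarrow>
     (\<forall>xs. set xs \<subseteq> V \<and> length xs \<le> l - 1 \<and> good F xs \<longrightarrow>
        card {x \<in> V. \<not> good F (xs @ [x])} \<le> L)"

definition prefix_property :: "'a set \<Rightarrow> nat \<Rightarrow> 'a list set \<Rightarrow> nat \<Rightarrow> bool" where
  "prefix_property V l F L' \<longleftrightarrow>
     (\<forall>xs. set xs \<subseteq> V \<and> length xs \<le> l - 1 \<and> good F xs \<longrightarrow>
        card {x \<in> V. \<not> good F (x # xs)} \<le> L')"

definition symmetric :: "'a set \<Rightarrow> nat \<Rightarrow> 'a list set \<Rightarrow> bool" where
  "symmetric V l F \<longleftrightarrow>
     (\<forall>xs. set xs \<subseteq> V \<and> length xs \<le> l - 1 \<and> good F xs \<longrightarrow>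
        {x \<in> V. \<not> good F (xs @ [x])} = {x \<in> V. \<not> good F (x # xs)})"

text \<open>A sequence of length \<open>2 * l - 2\<close> is represented by its two halves \<open>xs\<close> and \<open>ys\<close>.\<close>

definition insertion_property :: "'a set \<Rightarrow> nat \<Rightarrow> 'a list set \<Rightarrow> nat \<Rightarrow> bool" where
  "insertion_property V l F K \<longleftrightarrow>
     (\<forall>xs ys. set (xs @ ys) \<subseteq> V \<and> length xs = l - 1 \<and> length ys = l - 1 \<and>
        lgood l F (xs @ ys) \<longrightarrow>
        card {x \<in> V. lgood l F (xs @ [x]) \<and> lgood l F (x # ys) \<and>
                     \<not> lgood l F (xs @ [x] @ ys)} \<le> K)"

definition reachability_property ::
  "'a set \<Rightarrow> nat \<Rightarrow> 'a list set \<Rightarrow> nat \<Rightarrow> nat \<Rightarrow> bool" where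
  "reachability_property V l F J s \<longleftrightarrow>
     (\<forall>W xs w. W \<subseteq> V \<and> card W \<ge> J \<and>
        partial_sequencing V xs \<and> lgood l F xs \<and> length xs = l - 1 \<and> set xs \<inter> W = {} \<and>
        w \<in> W \<longrightarrow>
        (\<exists>ws. set ws \<subseteq> W \<and> length ws = s \<and>
           partial_sequencing V (xs @ ws @ [w]) \<and> lgood l F (xs @ ws @ [w])))"

end

theory Submission
  imports Defs "HOL-Library.Multiset"
begin

text \<open>
  The suffix property makes the greedy algorithm succeed as long as more than \<open>L\<close> elements are
  available: at most \<open>L\<close> of them are forbidden after the current last \<open>l - 1\<close> entries. The problem is
  the last few elements, at most \<open>L\<close>, which greed cannot place. They are inserted near the beginning of the
  sequence instead, and everything before that serves to guarantee that this works.

  Greedily build a sequence \<open>A\<close> that consists of \<open>L\<close> blocks of length \<open>l - 1\<close>, and regard the gap in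
  front of each block as a slot. Whether a new element \<open>x\<close> fits into a slot depends only on the
  neighbouring blocks, and insertions into different slots do not affect each other, because no
  segment of length \<open>l\<close> can contain entries on both sides of a whole block
  (\<open>locally_good_glue\<close>, \<open>locally_good_weave\<close>). The suffix, prefix and insertion properties leave few
  elements that fail to fit into a given slot, so the elements that fail in at least one slot lie in
  a set \<open>B\<close> of size at most \<open>(M + K) * L\<close>. Here \<open>M\<close> bounds the number of elements that fail at the
  left or at the right end of a given block: it is \<open>L + L'\<close> in general, and \<open>L\<close> if the family is
  symmetric, as both ends of a block then exclude the same elements.

  Next, extend \<open>A\<close> until \<open>B\<close> is used up: greedily while more than \<open>L\<close> elements of \<open>B\<close> remain
  (\<open>greedy_absorb\<close>), and then one at a time by the reachability property, at the price of \<open>s\<close> other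
  elements each (\<open>reachability_absorb\<close>). The lower bound on \<open>n\<close> is what ensures that \<open>J\<close> unused
  elements are always left for this. Finally, continue greedily until at most \<open>L\<close> elements are left.
  None of them is in \<open>B\<close>, so any of them fits into any slot, and there are \<open>L\<close> slots.
\<close>

section \<open>Local goodness and gluing\<close>

text \<open>
  Distinctness is a global condition and local goodness is not; gluing arguments concern only the
  latter.
\<close>

definition locally_good :: "nat \<Rightarrow> 'a list set \<Rightarrow> 'a list \<Rightarrow> bool" where
  "locally_good l F xs \<longleftrightarrow> (\<forall>ys. sublist ys xs \<and> length ys \<le> l \<longrightarrow> good F ys)"

lemma lgood_iff: "lgood l F xs \<longleftrightarrow> distinct xs \<and> locally_good l F xs"
  by (simp add: lgood_def locally_good_def)

lemma good_subseq: "good F xs \<Longrightarrow> subseq ys xs \<Longrightarrow> good F ys"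
  unfolding good_def using subseq_order.trans by blast

lemma good_imp_locally_good: "good F xs \<Longrightarrow> locally_good l F xs"
  unfolding locally_good_def using good_subseq sublist_imp_subseq by blast

lemma locally_good_imp_good: "locally_good l F xs \<Longrightarrow> length xs \<le> l \<Longrightarrow> good F xs"
  by (simp add: locally_good_def)

lemma locally_good_sublist: "locally_good l F xs \<Longrightarrow> sublist ys xs \<Longrightarrow> locally_good l F ys"
  unfolding locally_good_def using sublist_order.order.trans by blast

lemma lgood_sublist: "lgood l F xs \<Longrightarrow> sublist ys xs \<Longrightarrow> lgood l F ys"
  by (auto simp: lgood_iff sublist_def intro: locally_good_sublist)

text \<open>
  A segment that leaves both \<open>p @ q\<close> and \<open>q @ r\<close> contains all of \<open>q\<close> and one entry on either side.
\<close>

lemma sublist_append_overlap: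
  assumes "sublist ys (p @ q @ r)" and "length ys \<le> Suc (length q)"
  shows "sublist ys (p @ q) \<or> sublist ys (q @ r)"
proof -
  obtain u v where uv: "p @ q @ r = u @ ys @ v"
    using assms(1) by (auto simp: sublist_def)
  show ?thesis
  proof (cases "length p \<le> length u")
    case True
    then obtain u' where "u = p @ u'"
      using uv by (metis append_eq_append_conv_if append_take_drop_id)
    then have "q @ r = u' @ ys @ v" using uv by simp
    then show ?thesis by (metis sublist_appendI)
  next
    case False
    then have len: "length (u @ ys) \<le> length (p @ q)" using assms(2) by simp
    have "(u @ ys) @ v = (p @ q) @ r" using uv by simp
    then have "prefix (u @ ys) (p @ q)"
      using len by (metis prefixI prefix_length_prefix)
    then show ?thesis
      by (metis prefix_imp_sublist sublist_append_leftI sublist_order.order.trans)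
  qed
qed

lemma locally_good_glue:
  assumes "locally_good l F (p @ q)" and "locally_good l F (q @ r)" and "l \<le> Suc (length q)"
  shows "locally_good l F (p @ q @ r)"
  unfolding locally_good_def
proof (intro allI impI, elim conjE)
  fix ys assume ys: "sublist ys (p @ q @ r)" "length ys \<le> l"
  then have "sublist ys (p @ q) \<or> sublist ys (q @ r)"
    using assms(3) by (intro sublist_append_overlap) auto
  then show "good F ys" using assms(1,2) ys(2) by (auto simp: locally_good_def)
qed

text \<open>
  Only the last \<open>l - 1\<close> entries matter for an extension at the right. A shorter sequence is kept
  whole, by truncated subtraction.
\<close>

lemma locally_good_append_last:
  assumes "locally_good l F xs" and "locally_good l F (drop (length xs - (l - 1)) xs @ ys)"
  shows "locally_good l F (xs @ ys)"
proof (cases "l - 1 \<le> length xs")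
  case True
  let ?k = "length xs - (l - 1)"
  have "locally_good l F (take ?k xs @ drop ?k xs @ ys)"
    by (rule locally_good_glue) (use assms True in auto)
  then show ?thesis by (simp flip: append_assoc)
qed (use assms in simp)

section \<open>Extending a good sequence\<close>

lemma greedy_step:
  assumes "suffix_property V l F L" and "l > 0" and "finite V"
    and "set xs \<subseteq> V" and "lgood l F xs"
    and "T \<subseteq> V" and "card (T - set xs) > L"
  obtains x where "x \<in> T - set xs" and "lgood l F (xs @ [x])"
proof -
  let ?q = "drop (length xs - (l - 1)) xs"
  let ?bad = "{x \<in> V. \<not> good F (?q @ [x])}"
  have "locally_good l F ?q"
    using assms(5) locally_good_sublist sublist_drop unfolding lgood_iff by blast
  then have "good F ?q" by (rule locally_good_imp_good) (use assms(2) in simp)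
  moreover have "set ?q \<subseteq> V" using assms(4) set_drop_subset by (rule subset_trans[rotated])
  ultimately have "card ?bad \<le> L"
    using assms(1) unfolding suffix_property_def by simp
  then have "\<not> T - set xs \<subseteq> ?bad"
    using assms(3,7) card_mono[of ?bad "T - set xs"] by auto
  then obtain x where x: "x \<in> T - set xs" "good F (?q @ [x])"
    using assms(6) by blast
  have "locally_good l F (xs @ [x])"
    by (rule locally_good_append_last)
      (use assms(5) good_imp_locally_good[OF x(2)] in \<open>simp_all add: lgood_iff\<close>)
  then have "lgood l F (xs @ [x])" using assms(5) x(1) by (simp add: lgood_iff)
  then show thesis using that x(1) by blast
qed

lemma greedy_of_length:
  assumes "suffix_property V l F L" and "l > 0" and "finite V" and "N + L \<le> card V"
  shows "\<exists>xs. set xs \<subseteq> V \<and> lgood l F xs \<and> length xs = N"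
  using assms(4)
proof (induction N)
  case 0
  then show ?case by (auto simp: lgood_def good_def intro!: exI[of _ "[]"])
next
  case (Suc N)
  then obtain xs where xs: "set xs \<subseteq> V" "lgood l F xs" "length xs = N" by auto
  have "card (V - set xs) > L"
    using Suc.prems xs card_Diff_subset[of "set xs" V] card_length[of xs] by simp
  then obtain x where "x \<in> V - set xs" "lgood l F (xs @ [x])"
    using greedy_step[OF assms(1-3) xs(1,2)] by blast
  then show ?case using xs by (auto intro!: exI[of _ "xs @ [x]"])
qed

text \<open>
  Greedy choices may be confined to any target set \<open>T\<close>. This is used both to get rid of a set of
  troublesome elements and, with \<open>T = V\<close>, to exhaust nearly everything.
\<close>

lemma greedy_absorb:
  assumes "suffix_property V l F L" and "l > 0" and "finite V"
    and "set xs \<subseteq> V" and "lgood l F xs" and "T \<subseteq> V"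
  shows "\<exists>ys. set ys \<subseteq> T \<and> lgood l F (xs @ ys) \<and> card (T - set (xs @ ys)) \<le> L"
  using assms(4,5)
proof (induction "card (T - set xs)" arbitrary: xs rule: less_induct)
  case less
  show ?case
  proof (cases "card (T - set xs) \<le> L")
    case True
    then show ?thesis using less.prems by (intro exI[of _ "[]"]) simp
  next
    case False
    then obtain x where x: "x \<in> T - set xs" "lgood l F (xs @ [x])"
      using greedy_step[OF assms(1-3) less.prems assms(6)] by (metis not_le)
    have "T - set (xs @ [x]) \<subset> T - set xs" using x(1) by auto
    then have "card (T - set (xs @ [x])) < card (T - set xs)"
      using assms(3,6) by (meson finite_Diff finite_subset psubset_card_mono)
    from less.hyps[OF this] obtain ys where
      "set ys \<subseteq> T" "lgood l F ((xs @ [x]) @ ys)" "card (T - set ((xs @ [x]) @ ys)) \<le> L"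
      using less.prems x assms(6) by auto
    then show ?thesis using x(1) by (intro exI[of _ "x # ys"]) simp
  qed
qed

text \<open>
  Each detour uses \<open>s + 1\<close> entries and removes at least one element from \<open>T\<close>. Thus the numerical
  hypothesis is preserved, and it leaves at least \<open>J\<close> unused elements at the start of each detour.
\<close>

lemma reachability_absorb:
  assumes "reachability_property V l F J s" and "finite V"
    and "set xs \<subseteq> V" and "lgood l F xs" and "l - 1 \<le> length xs" and "T \<subseteq> V"
    and "length xs + card (T - set xs) * (s + 1) + J \<le> card V"
  shows "\<exists>ys. set ys \<subseteq> V \<and> lgood l F (xs @ ys) \<and> T \<subseteq> set (xs @ ys)"
  using assms(3-5,7)
proof (induction "card (T - set xs)" arbitrary: xs rule: less_induct)
  case less
  show ?case
  proof (cases "T \<subseteq> set xs")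
    case True
    then show ?thesis using less.prems by (intro exI[of _ "[]"]) simp
  next
    case False
    then obtain w where w: "w \<in> T" "w \<notin> set xs" by blast
    let ?W = "V - set xs" and ?q = "drop (length xs - (l - 1)) xs"
    have fin: "finite (T - set xs)" using assms(2,6) by (meson finite_Diff finite_subset)
    have q: "set ?q \<subseteq> set xs" by (rule set_drop_subset)
    have "card ?W \<ge> J"
      using less.prems card_Diff_subset[of "set xs" V] card_length[of xs] by simp
    moreover have "lgood l F ?q"
      using less.prems(2) locally_good_sublist[OF _ sublist_drop] by (auto simp: lgood_iff)
    moreover have "partial_sequencing V ?q"
      using less.prems(1,2) q by (auto simp: partial_sequencing_def lgood_def)
    moreover have "length ?q = l - 1" using less.prems(3) by simp
    moreover have "set ?q \<inter> ?W = {}" "w \<in> ?W" "?W \<subseteq> V" using q w assms(6) by auto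
    ultimately obtain ws where ws: "set ws \<subseteq> ?W" "length ws = s" "lgood l F (?q @ ws @ [w])"
      using assms(1) unfolding reachability_property_def by meson
    let ?xs = "xs @ ws @ [w]"
    have "locally_good l F ?xs"
      by (rule locally_good_append_last) (use less.prems(2) ws(3) in \<open>simp_all add: lgood_iff\<close>)
    moreover have "distinct ?xs"
      using less.prems(2) ws(1,3) w(2) by (auto simp: lgood_iff)
    ultimately have good': "lgood l F ?xs" by (simp add: lgood_iff)
    have "T - set ?xs \<subset> T - set xs" using w by auto
    then have smaller: "card (T - set ?xs) < card (T - set xs)"
      by (rule psubset_card_mono[OF fin])
    then have "Suc (card (T - set ?xs)) * (s + 1) \<le> card (T - set xs) * (s + 1)"
      by (intro mult_le_mono1) simp
    then have "length ?xs + card (T - set ?xs) * (s + 1) + J \<le> card V"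
      using less.prems(4) ws(2) by simp
    then obtain ys where
      "set ys \<subseteq> V" "lgood l F (?xs @ ys)" "T \<subseteq> set (?xs @ ys)"
      using less.hyps[OF smaller _ good'] less.prems(1,3) ws(1) w(1) assms(6) by auto
    then show ?thesis using ws(1) w(1) assms(6)
      by (intro exI[of _ "ws @ [w] @ ys"]) auto
  qed
qed

section \<open>Inserting elements between blocks\<close>

lemma split_into_blocks:
  "length xs = k * m \<Longrightarrow> \<exists>bs. concat bs = xs \<and> length bs = k \<and> (\<forall>b \<in> set bs. length b = m)"
proof (induction k arbitrary: xs)
  case (Suc k)
  then have "length (drop m xs) = k * m" by simp
  then obtain bs where "concat bs = drop m xs" "length bs = k" "\<forall>b \<in> set bs. length b = m"
    using Suc.IH by blast
  then show ?case using Suc.prems by (intro exI[of _ "take m xs # bs"]) auto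
qed simp

lemma sublist_concat_adjacent:
  "(b, c) \<in> set (zip bs (tl bs)) \<Longrightarrow> sublist (b @ c) (concat bs)"
proof (induction bs)
  case (Cons a bs)
  show ?case
  proof (cases bs)
    case (Cons a' bs')
    show ?thesis
    proof (cases "(b, c) = (a, a')")
      case True
      then show ?thesis using Cons
        by (metis (no_types) Pair_inject append_assoc concat.simps(2) prefixI prefix_imp_sublist)
    next
      case False
      then have "sublist (b @ c) (concat bs)" using Cons.prems Cons.IH Cons by auto
      then show ?thesis by (metis concat.simps(2) sublist_append_leftI sublist_order.order.trans)
    qed
  qed (use Cons.prems in simp)
qed simp

lemma sublist_concat_member: "b \<in> set bs \<Longrightarrow> sublist b (concat bs)"
  by (metis concat.simps(2) concat_append in_set_conv_decomp sublist_appendI)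

fun weave :: "'a list \<Rightarrow> 'a list list \<Rightarrow> 'a list" where
  "weave (x # xs) (b # bs) = x # b @ weave xs bs"
| "weave xs bs = concat bs"

lemma mset_weave: "length xs \<le> length bs \<Longrightarrow> mset (weave xs bs) = mset xs + mset (concat bs)"
  by (induction xs bs rule: weave.induct) auto

text \<open>
  The first block after an inserted element serves as the overlap: what precedes it is controlled
  by the insertion hypothesis and what follows it by induction. The block \<open>b\<close> to the left is carried
  along because the slot behind it depends on it.
\<close>

lemma locally_good_append_weave:
  assumes "locally_good l F (b @ concat bs @ t)"
    and "\<forall>c \<in> set (b # bs). length c = l - 1"
    and "\<forall>x \<in> set xs. \<forall>(c, d) \<in> set (zip (b # bs) bs). locally_good l F (c @ [x] @ d)"
  shows "locally_good l F (b @ weave xs bs @ t)"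
  using assms
proof (induction xs bs arbitrary: b rule: weave.induct)
  case (1 x xs c bs)
  have "locally_good l F (c @ concat bs @ t)"
    using 1(2) by (rule locally_good_sublist) (simp add: sublist_append_leftI)
  then have tail: "locally_good l F (c @ weave xs bs @ t)"
    using 1(3,4) by (intro 1(1)) auto
  have "locally_good l F ((b @ [x]) @ c)" using 1(4) by simp
  from this tail have "locally_good l F ((b @ [x]) @ c @ weave xs bs @ t)"
    by (rule locally_good_glue) (use 1(3) in auto)
  then show ?case by simp
qed auto

text \<open>The slot in front of the first block has no left neighbour, so only its right end matters.\<close>

lemma locally_good_weave:
  assumes "locally_good l F (concat bs @ t)"
    and "\<forall>c \<in> set bs. length c = l - 1"
    and "length xs \<le> length bs"
    and "\<forall>x \<in> set xs. \<forall>c \<in> set bs. locally_good l F (x # c)"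
    and "\<forall>x \<in> set xs. \<forall>(c, d) \<in> set (zip bs (tl bs)). locally_good l F (c @ [x] @ d)"
  shows "locally_good l F (weave xs bs @ t)"
proof (cases xs)
  case (Cons x xs')
  then obtain b bs' where bs: "bs = b # bs'" using assms(3) by (cases bs) auto
  have tail: "locally_good l F (b @ weave xs' bs' @ t)"
    using assms bs Cons by (intro locally_good_append_weave) auto
  have "locally_good l F ([x] @ b)" using assms(4) bs Cons by simp
  from this tail have "locally_good l F ([x] @ b @ weave xs' bs' @ t)"
    by (rule locally_good_glue) (use assms(2) bs in auto)
  then show ?thesis using bs Cons by simp
qed (use assms in simp)

section \<open>Existence of good sequencings\<close>

text \<open>
  The parameter \<open>M\<close> merges the general and the symmetric case: they differ only in how many elements
  can fail at one of the two ends of a block.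
\<close>

lemma lgood_sequencing_exists:
  assumes "l > 0" and "finite V"
    and suffix: "suffix_property V l F L"
    and insertion: "insertion_property V l F K"
    and reach: "reachability_property V l F J s"
    and ends: "\<And>b. \<lbrakk>set b \<subseteq> V; length b \<le> l - 1; good F b\<rbrakk> \<Longrightarrow>
      card {x \<in> V. \<not> good F (b @ [x]) \<or> \<not> good F (x # b)} \<le> M"
    and large: "l * L + (M + K) * L + s * L + J \<le> card V"
  shows "\<exists>xs. sequencing V xs \<and> lgood l F xs"
proof -
  have lL: "L * (l - 1) + L = l * L"
    using assms(1) by (cases l) (simp_all add: algebra_simps)
  \<comment> \<open>\<open>L\<close> blocks provide \<open>L\<close> slots, one in front of each block. A slot behind the last block would
    need a further block after it, for which the budget \<open>l * L\<close> need not suffice.\<close>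
  obtain A where A: "set A \<subseteq> V" "lgood l F A" "length A = L * (l - 1)"
    using greedy_of_length[OF suffix assms(1,2), of "L * (l - 1)"] large lL by auto
  obtain bs where bs: "concat bs = A" "length bs = L" "\<forall>b \<in> set bs. length b = l - 1"
    using split_into_blocks[OF A(3)] by blast
  have block: "lgood l F b" "good F b" "set b \<subseteq> V" "set b \<subseteq> set A" if "b \<in> set bs" for b
  proof -
    have sub: "sublist b A" using sublist_concat_member[OF that] bs(1) by simp
    then show "lgood l F b"
      by (rule lgood_sublist[OF A(2)])
    then show "good F b"
      using that bs(3) by (intro locally_good_imp_good[of l]) (auto simp: lgood_iff)
    show "set b \<subseteq> set A" using sub by (rule set_mono_sublist)
    then show "set b \<subseteq> V" using A(1) by blast
  qed
  let ?E = "\<lambda>b. {x \<in> V. \<not> good F (b @ [x]) \<or> \<not> good F (x # b)}"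
  let ?I = "\<lambda>(b, c). {x \<in> V. lgood l F (b @ [x]) \<and> lgood l F (x # c) \<and> \<not> lgood l F (b @ [x] @ c)}"
  let ?P = "set (zip bs (tl bs))"
  have pair_blocks: "b \<in> set bs" "c \<in> set bs" if "(b, c) \<in> ?P" for b c
    using that by (auto dest: set_zip_leftD)
      (metis list.sel(2) list.set_sel(2) set_zip_rightD)

  \<comment> \<open>Contains every element outside \<open>A\<close> that does not fit into some slot. The failures at the two ends of a
    block are counted together, so that in the symmetric case they cost \<open>L\<close> per block instead of
    \<open>2 * L\<close>.\<close>
  define B where "B = (\<Union>b \<in> set bs. ?E b) \<union> (\<Union>p \<in> ?P. ?I p)"
  have BV: "B \<subseteq> V" by (auto simp: B_def)
  have cardB: "card B \<le> (M + K) * L"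
  proof -
    have "card (\<Union>b \<in> set bs. ?E b) \<le> (\<Sum>b \<in> set bs. card (?E b))"
      by (rule card_UN_le) simp
    also have "\<dots> \<le> card (set bs) * M"
      using ends block bs(3) by (intro sum_bounded_above[where 'a = nat, simplified]) auto
    also have "\<dots> \<le> L * M" using card_length[of bs] bs(2) by simp
    finally have E: "card (\<Union>b \<in> set bs. ?E b) \<le> L * M" .
    have pair: "card (?I p) \<le> K" if "p \<in> ?P" for p
    proof -
      obtain b c where p: "p = (b, c)" by (cases p)
      have mem: "b \<in> set bs" "c \<in> set bs" using pair_blocks that p by blast+
      have "sublist (b @ c) A" using that sublist_concat_adjacent bs(1) p by blast
      then have "lgood l F (b @ c)"
        by (rule lgood_sublist[OF A(2)])
      then show ?thesis
        using insertion mem bs(3) block(3) p unfolding insertion_property_def by simp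
    qed
    have "card (\<Union>p \<in> ?P. ?I p) \<le> (\<Sum>p \<in> ?P. card (?I p))"
      by (rule card_UN_le) simp
    also have "\<dots> \<le> card ?P * K"
      using pair by (intro sum_bounded_above[where 'a = nat, simplified]) auto
    also have "\<dots> \<le> L * K"
      using card_length[of "zip bs (tl bs)"] bs(2) by (intro mult_le_mono1) simp
    finally have "card (\<Union>p \<in> ?P. ?I p) \<le> L * K" .
    then show ?thesis
      using E card_Un_le[of "\<Union>b \<in> set bs. ?E b" "\<Union>p \<in> ?P. ?I p"]
      unfolding B_def by (simp add: algebra_simps)
  qed
  have finB: "finite B" using BV assms(2) by (rule finite_subset)

  \<comment> \<open>All of \<open>B\<close> has to be used up away from the slots. The greedy choice consumes only elements of
    \<open>B\<close>; the expensive detours of length \<open>s\<close> are left for the last at most \<open>L\<close> of them.\<close>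
  obtain ys where ys: "set ys \<subseteq> B" "lgood l F (A @ ys)" "card (B - set (A @ ys)) \<le> L"
    using greedy_absorb[OF suffix assms(1,2) A(1,2) BV] by blast
  obtain zs where zs: "set zs \<subseteq> V" "lgood l F (A @ ys @ zs)" "B \<subseteq> set (A @ ys @ zs)"
  proof (cases "L = 0")
    \<comment> \<open>Here \<open>A\<close> is empty, so \<open>A @ ys\<close> may be too short for the reachability property.\<close>
    case True
    then have "B \<subseteq> set (A @ ys)" using ys(3) finB by simp
    then show thesis using that[of "[]"] ys(2) by simp
  next
    case False
    let ?k = "card (B - set (A @ ys))"
    have "length ys = card (set ys)" using ys(2) by (simp add: lgood_def distinct_card)
    moreover have "card (set ys \<union> (B - set (A @ ys))) \<le> card B"
      using ys(1) finB by (intro card_mono) auto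
    moreover have "card (set ys \<union> (B - set (A @ ys))) = card (set ys) + ?k"
      using finB by (intro card_Un_disjoint) auto
    \<comment> \<open>An element of \<open>B\<close> counts once, whether it was placed greedily or is still waiting.\<close>
    ultimately have "length ys + ?k \<le> (M + K) * L" using cardB by simp
    moreover have "s * ?k \<le> s * L" using ys(3) by simp
    moreover have "?k * (s + 1) = ?k + s * ?k" by simp
    moreover have "length (A @ ys) = L * (l - 1) + length ys" using A(3) by simp
    ultimately have "length (A @ ys) + ?k * (s + 1) + J \<le> card V"
      using large lL by linarith
    moreover have "l - 1 \<le> length (A @ ys)" using A(3) False by (cases L) auto
    moreover have "set (A @ ys) \<subseteq> V" using A(1) ys(1) BV by auto
    ultimately obtain zs where
      "set zs \<subseteq> V" "lgood l F ((A @ ys) @ zs)" "B \<subseteq> set ((A @ ys) @ zs)"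
      using reachability_absorb[OF reach assms(2) _ ys(2) _ BV] by blast
    then show thesis using that by simp
  qed
  have cur: "set (A @ ys @ zs) \<subseteq> V" using A(1) ys(1) BV zs(1) by auto
  obtain t where t: "set t \<subseteq> V" "lgood l F ((A @ ys @ zs) @ t)"
      "card (V - set ((A @ ys @ zs) @ t)) \<le> L"
    using greedy_absorb[OF suffix assms(1,2) cur zs(2)] by auto

  let ?rest = "ys @ zs @ t"
  have rest: "lgood l F (A @ ?rest)" "set (A @ ?rest) \<subseteq> V" using t cur by auto
  obtain rs where rs: "set rs = V - set (A @ ?rest)" "distinct rs"
    using assms(2) finite_distinct_list by (metis finite_Diff)
  have len: "length rs \<le> length bs"
    using rs t(3) bs(2) distinct_card[OF rs(2)] by simp
  have free: "good F (b @ [x])" "good F (x # b)" if "x \<in> set rs" "b \<in> set bs" for x b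
    using that rs(1) zs(3) by (auto simp: B_def)
  have "locally_good l F (weave rs bs @ ?rest)"
  proof (rule locally_good_weave)
    show "locally_good l F (concat bs @ ?rest)" using rest(1) bs(1) by (simp add: lgood_iff)
    show "\<forall>x \<in> set rs. \<forall>(c, d) \<in> ?P. locally_good l F (c @ [x] @ d)"
    proof (clarify)
      fix x b c assume x: "x \<in> set rs" and p: "(b, c) \<in> ?P"
      have mem: "b \<in> set bs" "c \<in> set bs" using pair_blocks p by blast+
      have "x \<notin> set b" "x \<notin> set c" using x rs(1) block(4) mem by auto
      then have "lgood l F (b @ [x])" "lgood l F (x # c)"
        using block(1)[OF mem(1)] block(1)[OF mem(2)]
          good_imp_locally_good[OF free(1)[OF x mem(1)]]
          good_imp_locally_good[OF free(2)[OF x mem(2)]]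
        by (simp_all add: lgood_iff)
      moreover have "x \<notin> ?I (b, c)" using x p rs(1) zs(3) unfolding B_def by auto
      ultimately show "locally_good l F (b @ [x] @ c)"
        using x rs(1) by (auto simp: lgood_iff)
    qed
  qed (use bs(3) len free in \<open>auto intro: good_imp_locally_good\<close>)
  moreover have ms: "mset (weave rs bs @ ?rest) = mset (rs @ A @ ?rest)"
    using mset_weave[OF len] bs(1) by simp
  moreover have "distinct (rs @ A @ ?rest)" using rs rest(1) by (auto simp: lgood_def)
  ultimately have "lgood l F (weave rs bs @ ?rest)" "distinct (weave rs bs @ ?rest)"
    unfolding lgood_iff using mset_eq_imp_distinct_iff by blast+
  moreover have "set (weave rs bs @ ?rest) = V"
    using mset_eq_setD[OF ms] rs(1) rest(2) by auto
  ultimately have "sequencing V (weave rs bs @ ?rest) \<and> lgood l F (weave rs bs @ ?rest)"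
    unfolding sequencing_def partial_sequencing_def by (metis distinct_card order_refl)
  then show ?thesis by blast
qed

theorem theorem2:
  fixes V :: "'a set" and F :: "'a list set" and l n L L' K J s :: nat
  assumes "l > 0"
    and "finite V" and "card V = n"
    and "F \<subseteq> lists V"
    and "suffix_property V l F L"
    and "prefix_property V l F L'"
    and "insertion_property V l F K"
    and "reachability_property V l F J s"
  shows "(n \<ge> l * L + (L + L' + K) * L + s * L + J \<longrightarrow>
            (\<exists>xs. sequencing V xs \<and> lgood l F xs)) \<and>
         (symmetric V l F \<longrightarrow> n \<ge> l * L + (L + K) * L + s * L + J \<longrightarrow>
            (\<exists>xs. sequencing V xs \<and> lgood l F xs))"
proof (intro conjI impI)
  assume large: "n \<ge> l * L + (L + L' + K) * L + s * L + J"
  show "\<exists>xs. sequencing V xs \<and> lgood l F xs"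
  proof (rule lgood_sequencing_exists[OF assms(1,2,5,7,8)])
    fix b assume b: "set b \<subseteq> V" "length b \<le> l - 1" "good F b"
    have split: "{x \<in> V. \<not> good F (b @ [x]) \<or> \<not> good F (x # b)} =
        {x \<in> V. \<not> good F (b @ [x])} \<union> {x \<in> V. \<not> good F (x # b)}" by blast
    have "card {x \<in> V. \<not> good F (b @ [x])} \<le> L" "card {x \<in> V. \<not> good F (x # b)} \<le> L'"
      using b assms(5,6) by (auto simp: suffix_property_def prefix_property_def)
    then show "card {x \<in> V. \<not> good F (b @ [x]) \<or> \<not> good F (x # b)} \<le> L + L'"
      unfolding split using card_Un_le[of "{x \<in> V. \<not> good F (b @ [x])}" "{x \<in> V. \<not> good F (x # b)}"]
      by linarith
  qed (use large assms(3) in simp)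
next
  assume sym: "symmetric V l F" and large: "n \<ge> l * L + (L + K) * L + s * L + J"
  show "\<exists>xs. sequencing V xs \<and> lgood l F xs"
  proof (rule lgood_sequencing_exists[OF assms(1,2,5,7,8)])
    fix b assume b: "set b \<subseteq> V" "length b \<le> l - 1" "good F b"
    have "{x \<in> V. \<not> good F (b @ [x])} = {x \<in> V. \<not> good F (x # b)}"
      using sym b by (auto simp: symmetric_def)
    then have "{x \<in> V. \<not> good F (b @ [x]) \<or> \<not> good F (x # b)} = {x \<in> V. \<not> good F (b @ [x])}"
      by blast
    then show "card {x \<in> V. \<not> good F (b @ [x]) \<or> \<not> good F (x # b)} \<le> L"
      using b assms(5) by (simp add: suffix_property_def)
  qed (use large assms(3) in simp)
qed

end
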